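(* Let $G$ be a $\sigma$-compact, locally compact abelian group, $(X,G)$ a minimal continuous action and $m\in\mathbb{N}$, $m\geq 2$. The following are equivalent: (1) $(X,G)$ is compactly $m$-sensitive; (2) there exists $\delta>0$ such that for every nonempty open $U\subset X$ there exist $x_1,\dots,x_m\in X$ with $x_1\in U$, $(x_i,x_j)\in Q_2(X,G)$ for all $i,j\in\{1,\dots,m\}$, and $\inf_{g\in G}d(gx_i,gx_j)>\delta$ for all $i\neq j$ in $\{1,\dots,m\}$; (3) $r_c(X,G)\geq m$.
   Context: $G$ acts continuously on a compact metric space $(X,d)$; minimal means every orbit is dense. $(X,G)$ is compactly $m$-sensitive if there exists $\varepsilon>0$ such that for every nonempty open $U\subset X$ and every compact $K\subset G$ there exist $x_1,\dots,x_m\in U$ and $h\in G$ with $Kh\subset\{g\in G: d(gx_i,gx_j)>\varepsilon\ \forall i\neq j\}$. A pair $(x,y)$ is regionally proximal, $(x,y)\in Q_2(X,G)$, if for each $\varepsilon>0$ there exist $x',y'$ with $d(x,x')<\varepsilon$, $d(y,y')<\varepsilon$ and $g\in G$ with $d(gx',gy')<\varepsilon$. A pair $(x,y)$ is proximal if $\inf_{g\in G}d(gx,gy)=0$. $\pi_{eq}\colon X\to X_{eq}$ is the factor map onto the maximal equicontinuous factor. The coincidence rank $r_c(X,G)$ is $\sup\{n\in\mathbb{N}:\exists x_1,\dots,x_n\in\pi_{eq}^{-1}(y)$ with $(x_i,x_j)$ not proximal for all $i\neq j\}$, a quantity independent of $y\in X_{eq}$ for minimal actions. *)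

theory Defs
  imports "HOL-Analysis.Analysis" "HOL-Library.Extended_Nat"
begin

definition sigma_compact_type :: "'g::topological_space itself \<Rightarrow> bool" where
  "sigma_compact_type T \<longleftrightarrow>
     (\<exists>K :: nat \<Rightarrow> 'g set. (\<forall>n. compact (K n)) \<and> (\<Union>n. K n) = UNIV)"

definition continuous_action :: "('g::topological_ab_group_add \<Rightarrow> 'x::metric_space \<Rightarrow> 'x) \<Rightarrow> bool" where
  "continuous_action act \<longleftrightarrow>
     continuous_on UNIV (\<lambda>(g, x). act g x) \<and>
     (\<forall>x. act 0 x = x) \<and> (\<forall>g h x. act (g + h) x = act g (act h x))"

definition minimal_action :: "('g::topological_ab_group_add \<Rightarrow> 'x::metric_space \<Rightarrow> 'x) \<Rightarrow> bool" where
  "minimal_action act \<longleftrightarrow> (\<forall>x. closure (range (\<lambda>g. act g x)) = UNIV)"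

definition compactly_m_sensitive ::
  "('g::topological_ab_group_add \<Rightarrow> 'x::metric_space \<Rightarrow> 'x) \<Rightarrow> nat \<Rightarrow> bool" where
  "compactly_m_sensitive act m \<longleftrightarrow>
     (\<exists>\<epsilon>>0. \<forall>U. open U \<and> U \<noteq> {} \<longrightarrow> (\<forall>K. compact K \<longrightarrow>
        (\<exists>(xs :: nat \<Rightarrow> 'x) (h :: 'g). (\<forall>i<m. xs i \<in> U) \<and>
           (\<lambda>k. k + h) ` K \<subseteq>
             {g. \<forall>i<m. \<forall>j<m. i \<noteq> j \<longrightarrow> dist (act g (xs i)) (act g (xs j)) > \<epsilon>})))"

definition regionally_proximal ::
  "('g::topological_ab_group_add \<Rightarrow> 'x::metric_space \<Rightarrow> 'x) \<Rightarrow> ('x \<times> 'x) set" where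
  "regionally_proximal act =
     {(x, y). \<forall>\<epsilon>>0. \<exists>x' y' g. dist x x' < \<epsilon> \<and> dist y y' < \<epsilon> \<and>
                  dist (act g x') (act g y') < \<epsilon>}"

definition proximal :: "('g::topological_ab_group_add \<Rightarrow> 'x::metric_space \<Rightarrow> 'x) \<Rightarrow> 'x \<Rightarrow> 'x \<Rightarrow> bool" where
  "proximal act x y \<longleftrightarrow> (INF g. dist (act g x) (act g y)) = 0"

definition action_on :: "('g::topological_ab_group_add \<Rightarrow> 'y::metric_space \<Rightarrow> 'y) \<Rightarrow> 'y set \<Rightarrow> bool" where
  "action_on \<beta> Y \<longleftrightarrow> compact Y \<and>
     continuous_on (UNIV \<times> Y) (\<lambda>(g, y). \<beta> g y) \<and> (\<forall>g. \<beta> g ` Y \<subseteq> Y) \<and>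
     (\<forall>y\<in>Y. \<beta> 0 y = y) \<and> (\<forall>g h. \<forall>y\<in>Y. \<beta> (g + h) y = \<beta> g (\<beta> h y))"

definition equicontinuous_on :: "('g::topological_ab_group_add \<Rightarrow> 'y::metric_space \<Rightarrow> 'y) \<Rightarrow> 'y set \<Rightarrow> bool" where
  "equicontinuous_on \<beta> Y \<longleftrightarrow>
     (\<forall>\<epsilon>>0. \<exists>\<delta>>0. \<forall>y\<in>Y. \<forall>y'\<in>Y. dist y y' < \<delta> \<longrightarrow> (\<forall>g. dist (\<beta> g y) (\<beta> g y') < \<epsilon>))"

definition factor_map ::
  "('g::topological_ab_group_add \<Rightarrow> 'x::metric_space \<Rightarrow> 'x) \<Rightarrow> ('g \<Rightarrow> 'y::metric_space \<Rightarrow> 'y) \<Rightarrow> 'y set \<Rightarrow> ('x \<Rightarrow> 'y) \<Rightarrow> bool" where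
  "factor_map act \<beta> Y \<pi> \<longleftrightarrow> action_on \<beta> Y \<and> continuous_on UNIV \<pi> \<and> range \<pi> = Y \<and>
     (\<forall>g x. \<pi> (act g x) = \<beta> g (\<pi> x))"

definition equicontinuous_factor ::
  "('g::topological_ab_group_add \<Rightarrow> 'x::metric_space \<Rightarrow> 'x) \<Rightarrow> ('g \<Rightarrow> 'y::metric_space \<Rightarrow> 'y) \<Rightarrow> 'y set \<Rightarrow> ('x \<Rightarrow> 'y) \<Rightarrow> bool" where
  "equicontinuous_factor act \<beta> Y \<pi> \<longleftrightarrow> factor_map act \<beta> Y \<pi> \<and> equicontinuous_on \<beta> Y"

text \<open>Maximal equicontinuous factor: every equicontinuous factor factors through it.
  Every compact metric space embeds isometrically into l-infinity (bounded continuous functions on nat)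
  (Frechet embedding), so quantifying over equicontinuous factors living in that
  space covers all equicontinuous (metrizable) factors up to conjugacy.\<close>
definition max_equicontinuous_factor ::
  "('g::topological_ab_group_add \<Rightarrow> 'x::metric_space \<Rightarrow> 'x) \<Rightarrow> ('g \<Rightarrow> 'y::metric_space \<Rightarrow> 'y) \<Rightarrow> 'y set \<Rightarrow> ('x \<Rightarrow> 'y) \<Rightarrow> bool" where
  "max_equicontinuous_factor act \<beta> Y \<pi> \<longleftrightarrow> equicontinuous_factor act \<beta> Y \<pi> \<and>
     (\<forall>(\<gamma> :: 'g \<Rightarrow> (nat \<Rightarrow>\<^sub>C real) \<Rightarrow> (nat \<Rightarrow>\<^sub>C real)) Z \<psi>.
        equicontinuous_factor act \<gamma> Z \<psi> \<longrightarrow>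
        (\<exists>\<phi>. continuous_on Y \<phi> \<and> \<phi> ` Y = Z \<and> (\<forall>g. \<forall>y\<in>Y. \<phi> (\<beta> g y) = \<gamma> g (\<phi> y)) \<and>
             (\<forall>x. \<psi> x = \<phi> (\<pi> x))))"

definition coincidence_rank ::
  "('g::topological_ab_group_add \<Rightarrow> 'x::metric_space \<Rightarrow> 'x) \<Rightarrow> 'y set \<Rightarrow> ('x \<Rightarrow> 'y) \<Rightarrow> enat" where
  "coincidence_rank act Y \<pi> =
     Sup {enat n | n. \<exists>y\<in>Y. \<exists>xs :: nat \<Rightarrow> 'x. (\<forall>i<n. \<pi> (xs i) = y) \<and>
            (\<forall>i<n. \<forall>j<n. i \<noteq> j \<longrightarrow> \<not> proximal act (xs i) (xs j))}"

end

theory Submission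
  imports Defs
begin

text \<open>The key point is that if \<open>x\<^sub>1, \<dots>, x\<^sub>m\<close> lie in one fibre of \<open>\<pi>\<close>, then for every nonempty open
  \<open>U\<close> there are points \<open>y\<^sub>i\<close> arbitrarily close to \<open>x\<^sub>i\<close> and a single \<open>g\<close> with all \<open>g y\<^sub>i \<in> U\<close>.
  This is a variant of McMahon's argument. Fix an invariant finitely additive probability
  \<open>\<mu>\<close> on the abelian group and let \<open>J(z, w)\<close> be the limit, as \<open>r\<close> tends to 0, of the \<open>\<mu>\<close>-measure
  of the times at which both \<open>B(z, r)\<close> and \<open>B(w, r)\<close> meet \<open>U\<close>. By minimality \<open>J(z, z)\<close> is a
  positive constant \<open>c\<close>, and \<open>c - J\<close> is a continuous invariant pseudometric. It therefore defines
  an equicontinuous factor and vanishes on the fibres of \<open>\<pi>\<close>, so that up to small measure the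
  return times of small balls around the \<open>x\<^sub>i\<close> coincide.

  Condition (3) says that some \<open>m\<close>-tuple in a fibre is uniformly separated along its orbit.
  The key point turns such a tuple into sensitivity and shows that pairs in a fibre are regionally
  proximal. Conversely, compactly sensitive tuples taken in shrinking balls and pushed by
  \<open>h\<close> accumulate, by compactness and equicontinuity, at such a tuple.\<close>

section \<open>Invariant finitely additive probabilities on abelian groups\<close>

text \<open>The domain is the whole power set, so sets of return times need no measurability check,
  and a set function is a point of a product space to which Tychonoff's theorem applies.\<close>

definition fin_add_prob :: "('g set \<Rightarrow> real) \<Rightarrow> bool" where
  "fin_add_prob \<mu> \<longleftrightarrow> (\<forall>A. 0 \<le> \<mu> A) \<and> \<mu> UNIV = 1 \<and>
     (\<forall>A B. A \<inter> B = {} \<longrightarrow> \<mu> (A \<union> B) = \<mu> A + \<mu> B)"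

lemma fin_add_prob_nonneg: "fin_add_prob \<mu> \<Longrightarrow> 0 \<le> \<mu> A"
  by (simp add: fin_add_prob_def)

lemma fin_add_prob_UNIV: "fin_add_prob \<mu> \<Longrightarrow> \<mu> UNIV = 1"
  by (simp add: fin_add_prob_def)

lemma fin_add_prob_disjoint_Un:
  "fin_add_prob \<mu> \<Longrightarrow> A \<inter> B = {} \<Longrightarrow> \<mu> (A \<union> B) = \<mu> A + \<mu> B"
  by (simp add: fin_add_prob_def)

lemma fin_add_prob_Diff:
  assumes "fin_add_prob \<mu>"
  shows "\<mu> (A - B) = \<mu> A - \<mu> (A \<inter> B)"
proof -
  have "\<mu> ((A - B) \<union> (A \<inter> B)) = \<mu> (A - B) + \<mu> (A \<inter> B)"
    by (rule fin_add_prob_disjoint_Un[OF assms]) auto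
  moreover have "(A - B) \<union> (A \<inter> B) = A" by auto
  ultimately show ?thesis by simp
qed

lemma fin_add_prob_mono:
  assumes "fin_add_prob \<mu>" "A \<subseteq> B"
  shows "\<mu> A \<le> \<mu> B"
  using fin_add_prob_Diff[OF assms(1), of B A] fin_add_prob_nonneg[OF assms(1), of "B - A"] assms(2)
  by (simp add: Int_absorb1)

lemma fin_add_prob_empty: "fin_add_prob \<mu> \<Longrightarrow> \<mu> {} = 0"
  using fin_add_prob_disjoint_Un[of \<mu> "{}" "{}"] by simp

lemma fin_add_prob_le_1: "fin_add_prob \<mu> \<Longrightarrow> \<mu> A \<le> 1"
  using fin_add_prob_mono[of \<mu> A UNIV] by (simp add: fin_add_prob_UNIV)

lemma fin_add_prob_Un_Int:
  assumes "fin_add_prob \<mu>"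
  shows "\<mu> (A \<union> B) + \<mu> (A \<inter> B) = \<mu> A + \<mu> B"
proof -
  have "\<mu> (A \<union> (B - A)) = \<mu> A + \<mu> (B - A)"
    by (rule fin_add_prob_disjoint_Un[OF assms]) auto
  then show ?thesis using fin_add_prob_Diff[OF assms, of B A] by (simp add: Int_commute)
qed

lemma fin_add_prob_UN_le:
  assumes "fin_add_prob \<mu>" "finite I"
  shows "\<mu> (\<Union>i\<in>I. A i) \<le> (\<Sum>i\<in>I. \<mu> (A i))"
  using assms(2)
proof (induction I rule: finite_induct)
  case empty
  then show ?case using fin_add_prob_empty[OF assms(1)] by simp
next
  case (insert i I)
  then show ?case
    using fin_add_prob_Un_Int[OF assms(1), of "A i" "\<Union>i\<in>I. A i"]
      fin_add_prob_nonneg[OF assms(1), of "A i \<inter> (\<Union>i\<in>I. A i)"] by simp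
qed

text \<open>Tychonoff's theorem for the function type. It serves for set functions with values in
  \<open>{0..1}\<close> and for sequences of points of the phase space.\<close>

lemma compact_PiE_UNIV:
  fixes S :: "'i \<Rightarrow> 'b::topological_space set"
  assumes "\<And>i. compact (S i)"
  shows "compact (PiE UNIV S)"
  using assms by (metis compactin_PiE compactin_euclidean_iff euclidean_product_topology UNIV_I)

text \<open>Invariance under one more translation is gained by averaging over its first powers;
  the averages stay almost invariant under the earlier translations because these commute with it.\<close>
lemma exists_almost_invariant_fin_add_prob:
  fixes F :: "('g::ab_group_add \<times> nat) set"
  assumes "finite F"
  shows "\<exists>\<mu>. fin_add_prob \<mu> \<and>
    (\<forall>(h, n)\<in>F. \<forall>A. \<bar>\<mu> ((+) h ` A) - \<mu> A\<bar> \<le> 1 / real (Suc n))"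
  using assms
proof (induction F rule: finite_induct)
  case empty
  \<comment> \<open>The point mass at 0.\<close>
  have "fin_add_prob (\<lambda>A. indicator A (0::'g))"
    by (auto simp: fin_add_prob_def indicator_def)
  then show ?case by blast
next
  case (insert p F)
  obtain h0 n0 where p: "p = (h0, n0)" by (cases p)
  define T where "T = (\<lambda>A. (+) (h0::'g) ` A)"
  \<comment> \<open>Commutativity of the group enters here: it lets the earlier translations pass
    through the average.\<close>
  have T_comm: "(T ^^ k) ((+) h ` A) = (+) h ` (T ^^ k) A" for h k A
  proof (induction k)
    case (Suc k)
    then show ?case by (simp add: T_def image_image algebra_simps)
  qed simp
  have T_UNIV: "(T ^^ k) UNIV = UNIV" for k
    by (induction k) (auto simp: T_def image_iff intro: exI[of _ "_ - h0"])
  have T_Un: "(T ^^ k) (A \<union> B) = (T ^^ k) A \<union> (T ^^ k) B" for k A B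
    by (induction k) (auto simp: T_def)
  have T_disj: "(T ^^ k) A \<inter> (T ^^ k) B = {}" if "A \<inter> B = {}" for k A B
    using that by (induction k) (auto simp: T_def)
  obtain \<nu> where \<nu>: "fin_add_prob \<nu>"
    and inv: "\<And>h n A. (h, n) \<in> F \<Longrightarrow> \<bar>\<nu> ((+) h ` A) - \<nu> A\<bar> \<le> 1 / real (Suc n)"
    using insert.IH by blast
  define N where "N = Suc n0"
  define \<mu> where "\<mu> A = (\<Sum>k<N. \<nu> ((T ^^ k) A)) / N" for A
  have N: "real N > 0" by (simp add: N_def)
  have "fin_add_prob \<mu>"
    unfolding fin_add_prob_def
  proof (intro conjI allI impI)
    show "0 \<le> \<mu> A" for A
      unfolding \<mu>_def using fin_add_prob_nonneg[OF \<nu>] by (intro divide_nonneg_nonneg sum_nonneg) auto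
    show "\<mu> UNIV = 1" using N by (simp add: \<mu>_def T_UNIV fin_add_prob_UNIV[OF \<nu>])
    show "\<mu> (A \<union> B) = \<mu> A + \<mu> B" if "A \<inter> B = {}" for A B
      by (simp add: \<mu>_def T_Un fin_add_prob_disjoint_Un[OF \<nu> T_disj[OF that]] sum.distrib add_divide_distrib)
  qed
  moreover have "\<bar>\<mu> ((+) h ` A) - \<mu> A\<bar> \<le> 1 / real (Suc n)" if "(h, n) \<in> F" for h n A
  proof -
    have "\<bar>\<Sum>k<N. \<nu> ((+) h ` (T ^^ k) A) - \<nu> ((T ^^ k) A)\<bar> \<le> (\<Sum>k<N. 1 / real (Suc n))"
      by (rule order_trans[OF sum_abs sum_mono]) (rule inv[OF that])
    then have "\<bar>(\<Sum>k<N. \<nu> ((+) h ` (T ^^ k) A) - \<nu> ((T ^^ k) A)) / N\<bar> \<le> 1 / real (Suc n)"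
      using N by (simp add: field_simps)
    then show ?thesis
      by (simp add: \<mu>_def T_comm sum_subtractf diff_divide_distrib)
  qed
  \<comment> \<open>Translating by \<open>h0\<close> shifts the average by one index, so the
    difference telescopes to two values in the unit interval divided by \<open>N\<close>; hence the
    choice \<open>N = Suc n0\<close>.\<close>
  moreover have "\<bar>\<mu> ((+) h0 ` A) - \<mu> A\<bar> \<le> 1 / real (Suc n0)" for A
  proof -
    have "(+) h0 ` (T ^^ k) A = (T ^^ Suc k) A" for k by (simp add: T_def)
    then have "\<mu> ((+) h0 ` A) - \<mu> A = (\<Sum>k<N. \<nu> ((T ^^ Suc k) A) - \<nu> ((T ^^ k) A)) / N"
      by (simp only: \<mu>_def T_comm sum_subtractf diff_divide_distrib)
    also have "\<dots> = (\<nu> ((T ^^ N) A) - \<nu> A) / N"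
      by (subst sum_lessThan_telescope) simp
    also have "\<bar>\<dots>\<bar> \<le> 1 / N"
      using fin_add_prob_nonneg[OF \<nu>, of "(T ^^ N) A"] fin_add_prob_le_1[OF \<nu>, of "(T ^^ N) A"]
        fin_add_prob_nonneg[OF \<nu>, of A] fin_add_prob_le_1[OF \<nu>, of A] N
      by (simp add: abs_le_iff divide_right_mono field_simps)
    finally show ?thesis by (simp add: N_def)
  qed
  ultimately show ?case by (auto simp: p)
qed

text \<open>The constraints \<open>P\<close> and \<open>Q (h, n)\<close> are closed in a compact
  product of unit intervals. Any finitely many of them have a common point by almost invariance, so
  all of them do; as \<open>n\<close> is arbitrary, the bounds force equality.\<close>

lemma exists_invariant_fin_add_prob:
  obtains \<mu> :: "'g::ab_group_add set \<Rightarrow> real"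
  where "fin_add_prob \<mu>" and "\<And>h A. \<mu> ((+) h ` A) = \<mu> A"
proof -
  define P where "P = Collect (fin_add_prob :: ('g set \<Rightarrow> real) \<Rightarrow> bool)"
  define Q where "Q = (\<lambda>(h::'g, n). {\<mu>. \<forall>A. \<bar>\<mu> ((+) h ` A) - \<mu> A\<bar> \<le> 1 / real (Suc n)})"
  let ?box = "PiE UNIV (\<lambda>_. {0..1}) :: ('g set \<Rightarrow> real) set"
  have coord: "continuous_on UNIV (\<lambda>\<mu>. \<mu> A)" for A :: "'g set"
    by (rule continuous_on_product_coordinates)
  have P_closed: "closed P"
  proof -
    have "P = {\<mu>. \<forall>A. 0 \<le> \<mu> A} \<inter> {\<mu>. \<mu> UNIV = 1} \<inter>
        {\<mu>. \<forall>A B. A \<inter> B = {} \<longrightarrow> \<mu> (A \<union> B) = \<mu> A + \<mu> B}"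
      by (auto simp: P_def fin_add_prob_def)
    also have "closed \<dots>"
      by (intro closed_Int closed_Collect_all closed_Collect_imp closed_Collect_le closed_Collect_eq
          continuous_intros coord) (auto simp: open_Collect_const)
    finally show ?thesis .
  qed
  have Q_closed: "closed (Q p)" for p
    unfolding Q_def case_prod_unfold
    by (intro closed_Collect_all closed_Collect_le continuous_intros coord)
  have "?box \<inter> \<Inter> (insert P (range Q)) \<noteq> {}"
  proof (rule compact_imp_fip)
    show "compact ?box" by (rule compact_PiE_UNIV) simp
    show "closed T" if "T \<in> insert P (range Q)" for T using that P_closed Q_closed by auto
    fix \<F> assume "finite \<F>" "\<F> \<subseteq> insert P (range Q)"
    then have "finite (\<F> - {P})" "\<F> - {P} \<subseteq> range Q" by auto
    then obtain F where F: "finite F" "\<F> - {P} = Q ` F" by (metis finite_subset_image)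
    obtain \<mu> where \<mu>: "fin_add_prob \<mu>"
      and inv: "\<forall>(h, n)\<in>F. \<forall>A. \<bar>\<mu> ((+) h ` A) - \<mu> A\<bar> \<le> 1 / real (Suc n)"
      using exists_almost_invariant_fin_add_prob[OF F(1)] by blast
    have "\<mu> \<in> ?box" using fin_add_prob_nonneg[OF \<mu>] fin_add_prob_le_1[OF \<mu>] by auto
    moreover have "\<mu> \<in> P" using \<mu> by (simp add: P_def)
    moreover have "\<mu> \<in> Q p" if "p \<in> F" for p using inv that by (fastforce simp: Q_def)
    ultimately have "\<mu> \<in> ?box \<inter> \<Inter> \<F>" using F(2) by blast
    then show "?box \<inter> \<Inter> \<F> \<noteq> {}" by blast
  qed
  then obtain \<mu> where "\<mu> \<in> ?box \<inter> \<Inter> (insert P (range Q))" by (metis ex_in_conv)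
  then have \<mu>: "\<mu> \<in> P" "\<And>p. \<mu> \<in> Q p" by (blast, blast)
  have "\<mu> ((+) h ` A) = \<mu> A" for h A
  proof (rule ccontr)
    assume "\<mu> ((+) h ` A) \<noteq> \<mu> A"
    then obtain n where "1 / real (Suc n) < \<bar>\<mu> ((+) h ` A) - \<mu> A\<bar>"
      by (meson nat_approx_posE zero_less_abs_iff right_minus_eq)
    moreover have "\<bar>\<mu> ((+) h ` A) - \<mu> A\<bar> \<le> 1 / real (Suc n)"
      using \<mu>(2)[of "(h, n)"] by (auto simp: Q_def)
    ultimately show False by simp
  qed
  with \<mu>(1) show ?thesis using that by (auto simp: P_def)
qed

section \<open>Invariant pseudometrics and equicontinuous factors\<close>

lemma compact_dense_sequence:
  assumes "compact (UNIV :: 'x::metric_space set)"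
  obtains a :: "nat \<Rightarrow> 'x::metric_space" where "\<And>x e. e > 0 \<Longrightarrow> \<exists>n. dist x (a n) < e"
proof -
  have "\<forall>n. \<exists>k. finite k \<and> (UNIV :: 'x set) \<subseteq> (\<Union>x\<in>k. ball x (1 / real (Suc n)))"
    using assms unfolding compact_eq_totally_bounded by simp
  then obtain k where k: "\<And>n. finite (k n)"
    "\<And>n. (UNIV :: 'x set) \<subseteq> (\<Union>x\<in>k n. ball x (1 / real (Suc n)))" by metis
  define S where "S = (\<Union>n. k n)"
  have "countable S" unfolding S_def using k(1) by (intro countable_UN) (auto intro: countable_finite)
  have dense: "\<exists>s\<in>S. dist x s < e" if "e > 0" for x e
  proof -
    obtain n where n: "1 / real (Suc n) < e" by (rule nat_approx_posE[OF \<open>e > 0\<close>])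
    obtain s where "s \<in> k n" "x \<in> ball s (1 / real (Suc n))" using k(2)[of n] by blast
    then show ?thesis using n by (intro bexI[of _ s]) (auto simp: S_def dist_commute)
  qed
  then have "S \<noteq> {}" using zero_less_one by blast
  have "\<exists>n. dist x (from_nat_into S n) < e" if "e > 0" for x e
    using dense[OF that, of x] from_nat_into_surj[OF \<open>countable S\<close>] by metis
  then show ?thesis using that by blast
qed

section \<open>Elementary facts on continuous and minimal actions\<close>

lemma continuous_action_act:
  assumes "continuous_action act"
  shows "act 0 x = x" "act (g + h) x = act g (act h x)" "act (- g) (act g x) = x"
    "act g (act (- g) x) = x"
proof -
  show *: "act 0 x = x" "act (g + h) x = act g (act h x)" for x g h
    using assms by (auto simp: continuous_action_def)
  show "act (- g) (act g x) = x" "act g (act (- g) x) = x"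
    using *(2)[of "- g" g x] *(2)[of g "- g" x] *(1) by auto
qed

lemma continuous_action_continuous_on:
  assumes "continuous_action act"
  shows "continuous_on UNIV (act g)" "continuous_on UNIV (\<lambda>g. act g x)"
proof -
  have *: "continuous_on UNIV (\<lambda>(g, x). act g x)" using assms by (simp add: continuous_action_def)
  show "continuous_on UNIV (act g)"
    using continuous_on_compose2[OF *, of UNIV "\<lambda>x. (g, x)"]
    by (simp add: continuous_on_Pair)
  show "continuous_on UNIV (\<lambda>g. act g x)"
    using continuous_on_compose2[OF *, of UNIV "\<lambda>g. (g, x)"]
    by (simp add: continuous_on_Pair)
qed

lemma minimal_action_meets_open:
  assumes "minimal_action act" "open U" "U \<noteq> {}"
  obtains g where "act g x \<in> U"
proof -
  have "U \<inter> closure (range (\<lambda>g. act g x)) \<noteq> {}"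
    using assms by (simp add: minimal_action_def)
  then have "U \<inter> range (\<lambda>g. act g x) \<noteq> {}"
    using assms(2) open_Int_closure_eq_empty by blast
  then show ?thesis using that by auto
qed

text \<open>The factor is the image of the Kuratowski map sending \<open>x\<close> to its sequence of
  pseudodistances to a dense sequence.\<close>
lemma invariant_pseudometric_factors:
  fixes act :: "'g::topological_ab_group_add \<Rightarrow> 'x::metric_space \<Rightarrow> 'x"
    and D :: "'x \<Rightarrow> 'x \<Rightarrow> real"
  assumes cpt: "compact (UNIV :: 'x set)" and act: "continuous_action act"
    and mef: "max_equicontinuous_factor act \<beta> Y \<pi>"
    and nonneg: "\<And>x y. 0 \<le> D x y" and refl: "\<And>x. D x x = 0" and sym: "\<And>x y. D x y = D y x"
    and tri: "\<And>x y z. D x z \<le> D x y + D y z"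
    and inv: "\<And>g x y. D (act g x) (act g y) = D x y"
    and cont: "\<And>x e. e > 0 \<Longrightarrow> \<exists>r>0. \<forall>y. dist x y < r \<longrightarrow> D x y < e"
    and bound: "\<And>x y. D x y \<le> B"
    and eq: "\<pi> x = \<pi> y"
  shows "D x y = 0"
proof -
  obtain a :: "nat \<Rightarrow> 'x" where a: "\<And>x e. e > 0 \<Longrightarrow> \<exists>n. dist x (a n) < e"
    using compact_dense_sequence[OF cpt] by metis
  \<comment> \<open>The target is the space in which \<open>max_equicontinuous_factor\<close> tests
    equicontinuous factors; the bound \<open>B\<close> makes the sequences bounded.\<close>
  define \<psi> :: "'x \<Rightarrow> (nat \<Rightarrow>\<^sub>C real)" where "\<psi> x = Bcontfun (\<lambda>n. D x (a n))" for x
  have \<psi>: "apply_bcontfun (\<psi> x) n = D x (a n)" for x n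
    unfolding \<psi>_def
    by (subst Bcontfun_inverse) (auto intro!: bcontfun_normI[of _ B] simp: nonneg bound)
  have isom: "dist (\<psi> x) (\<psi> y) = D x y" for x y
  proof (rule antisym)
    show "dist (\<psi> x) (\<psi> y) \<le> D x y"
    proof (rule dist_bound)
      fix n
      show "dist (\<psi> x n) (\<psi> y n) \<le> D x y"
        using tri[of x "a n" y] tri[of y "a n" x] sym[of x y] by (auto simp: \<psi> dist_real_def)
    qed
    \<comment> \<open>A term \<open>a n\<close> close to \<open>x\<close> makes
      \<open>D x (a n)\<close> small, so coordinate \<open>n\<close> nearly recovers
      \<open>D x y\<close>.\<close>
    show "D x y \<le> dist (\<psi> x) (\<psi> y)"
    proof (rule field_le_epsilon)
      fix e :: real assume "e > 0"
      then obtain r where r: "r > 0" "\<And>z. dist x z < r \<Longrightarrow> D x z < e / 2"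
        using cont[of "e / 2" x] by auto
      obtain n where "dist x (a n) < r" using a[OF r(1)] by blast
      then have "D x (a n) < e / 2" by (rule r(2))
      moreover have "\<bar>D x (a n) - D y (a n)\<bar> \<le> dist (\<psi> x) (\<psi> y)"
        using dist_bounded[of "\<psi> x" n "\<psi> y"] by (simp add: \<psi> dist_real_def)
      ultimately show "D x y \<le> dist (\<psi> x) (\<psi> y) + e"
        using tri[of x y "a n"] sym[of y "a n"] by auto
    qed
  qed
  have \<psi>_cont: "continuous_on UNIV \<psi>"
    unfolding continuous_on_iff isom using cont sym by (metis dist_commute UNIV_I)
  \<comment> \<open>\<open>\<psi>\<close> identifies points at pseudodistance 0, so an arbitrary
    preimage is taken; invariance of \<open>D\<close> makes the value independent of this
    choice.\<close>
  define \<gamma> where "\<gamma> g z = \<psi> (act g (inv_into UNIV \<psi> z))" for g z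
  have \<gamma>: "\<gamma> g (\<psi> x) = \<psi> (act g x)" for g x
  proof -
    have "\<psi> (inv_into UNIV \<psi> (\<psi> x)) = \<psi> x" by (rule f_inv_into_f) simp
    then have "D (inv_into UNIV \<psi> (\<psi> x)) x = 0" by (metis isom dist_self)
    then have "dist (\<gamma> g (\<psi> x)) (\<psi> (act g x)) = 0" by (simp add: \<gamma>_def isom inv)
    then show ?thesis by simp
  qed
  have \<gamma>_isom: "dist (\<gamma> g z) (\<gamma> g z') = dist z z'" if "z \<in> range \<psi>" "z' \<in> range \<psi>" for g z z'
    using that by (auto simp: \<gamma> isom inv)
  \<comment> \<open>Each \<open>\<gamma> g\<close> is isometric on the image, so replacing
    \<open>z\<close> by the base point costs exactly their distance, uniformly in \<open>g\<close>.
    Joint continuity thus reduces to continuity of a single orbit map.\<close>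
  have \<gamma>_cont: "continuous_on (UNIV \<times> range \<psi>) (\<lambda>(g, z). \<gamma> g z)"
    unfolding continuous_on_def
  proof
    fix p assume "p \<in> (UNIV :: 'g set) \<times> range \<psi>"
    then obtain g0 x0 where p: "p = (g0, \<psi> x0)" by auto
    let ?F = "at (g0, \<psi> x0) within UNIV \<times> range \<psi>"
    have "continuous_on UNIV (\<lambda>g. \<psi> (act g x0))"
      by (rule continuous_on_compose2[OF \<psi>_cont continuous_action_continuous_on(2)[OF act]]) auto
    then have "((\<lambda>g. \<psi> (act g x0)) \<longlongrightarrow> \<psi> (act g0 x0)) (nhds g0)"
      by (simp add: continuous_on_def flip: tendsto_at_iff_tendsto_nhds[of "\<lambda>g. \<psi> (act g x0)"])
    moreover have "(fst \<longlongrightarrow> g0) ?F" "(snd \<longlongrightarrow> \<psi> x0) ?F"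
      by (auto intro!: tendsto_eq_intros tendsto_ident_at)
    ultimately have "((\<lambda>p. \<psi> (act (fst p) x0)) \<longlongrightarrow> \<psi> (act g0 x0)) ?F"
      using filterlim_compose by blast
    then have 1: "((\<lambda>p. dist (\<psi> (act (fst p) x0)) (\<psi> (act g0 x0))) \<longlongrightarrow> 0) ?F"
      by (rule tendsto_dist_iff[THEN iffD1])
    have 2: "((\<lambda>p. dist (snd p) (\<psi> x0)) \<longlongrightarrow> 0) ?F"
      using \<open>(snd \<longlongrightarrow> \<psi> x0) ?F\<close> by (rule tendsto_dist_iff[THEN iffD1])
    have "((\<lambda>p. dist (case p of (g, z) \<Rightarrow> \<gamma> g z) (\<gamma> g0 (\<psi> x0))) \<longlongrightarrow> 0) ?F"
    proof (rule tendsto_sandwich[OF _ _ tendsto_const])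
      show "((\<lambda>p. dist (snd p) (\<psi> x0) + dist (\<psi> (act (fst p) x0)) (\<psi> (act g0 x0))) \<longlongrightarrow> 0) ?F"
        using tendsto_add[OF 2 1] by simp
      show "\<forall>\<^sub>F p in ?F. dist (case p of (g, z) \<Rightarrow> \<gamma> g z) (\<gamma> g0 (\<psi> x0))
          \<le> dist (snd p) (\<psi> x0) + dist (\<psi> (act (fst p) x0)) (\<psi> (act g0 x0))"
        unfolding eventually_at_filter
      proof (rule always_eventually, clarify)
        fix g x
        have "dist (\<gamma> g (\<psi> x)) (\<gamma> g0 (\<psi> x0))
            \<le> dist (\<gamma> g (\<psi> x)) (\<gamma> g (\<psi> x0)) + dist (\<gamma> g (\<psi> x0)) (\<gamma> g0 (\<psi> x0))"
          by (rule dist_triangle)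
        then show "dist (\<gamma> g (\<psi> x)) (\<gamma> g0 (\<psi> x0))
            \<le> dist (snd (g, \<psi> x)) (\<psi> x0) + dist (\<psi> (act (fst (g, \<psi> x)) x0)) (\<psi> (act g0 x0))"
          by (simp add: \<gamma>_isom) (simp add: \<gamma>)
      qed
    qed simp
    then show "((\<lambda>(g, z). \<gamma> g z) \<longlongrightarrow> (case p of (g, z) \<Rightarrow> \<gamma> g z)) (at p within UNIV \<times> range \<psi>)"
      unfolding p prod.case by (rule tendsto_dist_iff[THEN iffD2])
  qed
  have "equicontinuous_factor act \<gamma> (range \<psi>) \<psi>"
    unfolding equicontinuous_factor_def factor_map_def action_on_def equicontinuous_on_def
  proof (intro conjI allI impI ballI)
    show "compact (range \<psi>)" by (rule compact_continuous_image[OF \<psi>_cont cpt])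
    show "\<gamma> g ` range \<psi> \<subseteq> range \<psi>" for g by (auto simp: \<gamma>)
    show "\<gamma> 0 z = z" if "z \<in> range \<psi>" for z
      using that by (auto simp: \<gamma> continuous_action_act[OF act])
    show "\<gamma> (g + h) z = \<gamma> g (\<gamma> h z)" if "z \<in> range \<psi>" for g h z
      using that by (auto simp: \<gamma> continuous_action_act[OF act])
    show "\<exists>\<delta>>0. \<forall>y\<in>range \<psi>. \<forall>y'\<in>range \<psi>. dist y y' < \<delta> \<longrightarrow> (\<forall>g. dist (\<gamma> g y) (\<gamma> g y') < \<epsilon>)"
      if "\<epsilon> > 0" for \<epsilon>
      using that \<gamma>_isom by (intro exI[of _ \<epsilon>]) auto
  qed (use \<gamma>_cont \<psi>_cont \<gamma> in auto)
  \<comment> \<open>By maximality \<open>\<psi>\<close> factors through \<open>\<pi>\<close>, so it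
    is constant on fibres.\<close>
  then obtain \<phi> where "\<And>x. \<psi> x = \<phi> (\<pi> x)"
    using mef unfolding max_equicontinuous_factor_def by metis
  then have "\<psi> x = \<psi> y" using eq by simp
  then show ?thesis by (metis isom dist_self)
qed

section \<open>Return times to an open set\<close>

lemma ball_subset_ball_half:
  fixes z w :: "'a::metric_space"
  assumes "dist z w < R / 2" "s \<le> R / 2"
  shows "ball w s \<subseteq> ball z R"
proof
  fix x assume "x \<in> ball w s"
  then show "x \<in> ball z R" using assms dist_triangle[of z x w] by simp
qed

locale return_times =
  fixes act :: "'g::topological_ab_group_add \<Rightarrow> 'x::metric_space \<Rightarrow> 'x"
    and \<mu> :: "'g set \<Rightarrow> real" and U :: "'x set"
  assumes cpt: "compact (UNIV :: 'x set)" and act: "continuous_action act"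
    and minimal: "minimal_action act"
    and prob: "fin_add_prob \<mu>" and invariant: "\<And>h A. \<mu> ((+) h ` A) = \<mu> A"
    and open_U: "open U" and U_nonempty: "U \<noteq> {}"
begin

text \<open>Recording visits of the whole ball makes the set monotone in the ball; this is what
  allows nearby centres to be compared.\<close>

definition ret :: "'x \<Rightarrow> real \<Rightarrow> 'g set" where
  "ret z r = {g. \<exists>y\<in>ball z r. act g y \<in> U}"

text \<open>This is the function \<open>J\<close> of the introduction: the sets shrink with
  \<open>r\<close>, so the infimum is the limit as \<open>r\<close> tends to 0.\<close>

definition common :: "'x \<Rightarrow> 'x \<Rightarrow> real" where
  "common z w = (INF r\<in>{0<..}. \<mu> (ret z r \<inter> ret w r))"

lemma ret_mono: "ball w s \<subseteq> ball z r \<Longrightarrow> ret w s \<subseteq> ret z r"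
  by (auto simp: ret_def)

lemma common_le: "r > 0 \<Longrightarrow> common z w \<le> \<mu> (ret z r \<inter> ret w r)"
  unfolding common_def
  by (rule cINF_lower) (auto intro!: bdd_belowI[of _ 0] fin_add_prob_nonneg[OF prob])

lemma common_greatest:
  assumes "\<And>r. r > 0 \<Longrightarrow> b \<le> \<mu> (ret z r \<inter> ret w r)"
  shows "b \<le> common z w"
  unfolding common_def by (rule cINF_greatest) (auto intro: assms gt_ex)

lemma common_nonneg: "0 \<le> common z w"
  by (rule common_greatest) (rule fin_add_prob_nonneg[OF prob])

lemma common_le_1: "common z w \<le> 1"
  using common_le[of 1] fin_add_prob_le_1[OF prob] order_trans zero_less_one by blast

lemma common_commute: "common z w = common w z"
  by (simp add: common_def Int_commute)

lemma common_approx: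
  assumes "e > 0"
  obtains R where "R > 0" "\<And>r. r \<le> R \<Longrightarrow> \<mu> (ret z r \<inter> ret w r) < common z w + e"
proof -
  obtain R where R: "R > 0" "\<mu> (ret z R \<inter> ret w R) < common z w + e"
    using common_greatest[of "common z w + e" z w] assms by (meson less_add_same_cancel1 not_le)
  have "\<mu> (ret z r \<inter> ret w r) < common z w + e" if "r \<le> R" for r
  proof -
    have "ret z r \<inter> ret w r \<subseteq> ret z R \<inter> ret w R"
      using that by (intro Int_mono ret_mono) auto
    from fin_add_prob_mono[OF prob this] R(2) show ?thesis by simp
  qed
  with R(1) show ?thesis using that by blast
qed

text \<open>Continuity of \<open>act h\<close> sends small balls into the balls of radius
  \<open>r\<close>, so a return time \<open>g\<close> of the small balls yields the return time
  \<open>g - h\<close> of the images. Invariance of \<open>\<mu>\<close> absorbs the shift.\<close>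

lemma common_act_le: "common z w \<le> common (act h z) (act h w)"
proof (rule common_greatest)
  fix r :: real assume "r > 0"
  have near: "\<exists>s>0. act h ` ball z s \<subseteq> ball (act h z) r" for z
  proof -
    have "open (act h -` ball (act h z) r)"
      by (rule open_vimage[OF open_ball continuous_action_continuous_on(1)[OF act]])
    then show ?thesis using \<open>r > 0\<close> by (force simp: open_contains_ball)
  qed
  obtain s t where st: "s > 0" "t > 0" "act h ` ball z s \<subseteq> ball (act h z) r"
    "act h ` ball w t \<subseteq> ball (act h w) r"
    using near[of z] near[of w] by blast
  define u where "u = min s t"
  have "g - h \<in> ret (act h v) r" if "g \<in> ret v u" "act h ` ball v u \<subseteq> ball (act h v) r" for g v
  proof -
    obtain y where y: "y \<in> ball v u" "act g y \<in> U" using \<open>g \<in> ret v u\<close> by (auto simp: ret_def)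
    have "act (g - h) (act h y) = act g y"
      using continuous_action_act(2)[OF act, of "g - h" h y] by simp
    moreover have "act h y \<in> ball (act h v) r" using y(1) that(2) by blast
    ultimately show ?thesis using y(2) unfolding ret_def by (intro CollectI bexI[of _ "act h y"]) auto
  qed
  moreover have "act h ` ball z u \<subseteq> ball (act h z) r" "act h ` ball w u \<subseteq> ball (act h w) r"
    using st(3,4) by (auto simp: u_def)
  ultimately have "ret z u \<inter> ret w u \<subseteq> (+) h ` (ret (act h z) r \<inter> ret (act h w) r)"
    by (auto intro!: image_eqI[of _ "(+) h" "_ - h"])
  then have "\<mu> (ret z u \<inter> ret w u) \<le> \<mu> (ret (act h z) r \<inter> ret (act h w) r)"
    using fin_add_prob_mono[OF prob] invariant by metis
  moreover have "common z w \<le> \<mu> (ret z u \<inter> ret w u)"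
    by (rule common_le) (simp add: u_def st)
  ultimately show "common z w \<le> \<mu> (ret (act h z) r \<inter> ret (act h w) r)" by simp
qed

lemma common_act: "common (act h z) (act h w) = common z w"
  using common_act_le[of "act h z" "act h w" "- h"] common_act_le[of z w h]
  by (simp add: continuous_action_act[OF act])

text \<open>\<open>common z z\<close> is upper semicontinuous and invariant in \<open>z\<close>, so minimality forces it
  to be constant.\<close>
lemma common_self_const: "common z z = common w w"
proof -
  have "common w w \<le> common z z" for z w
  proof (rule field_le_epsilon)
    fix e :: real assume "e > 0"
    then obtain R where R: "R > 0" "\<mu> (ret z R \<inter> ret z R) < common z z + e"
      by (metis common_approx order_refl)
    obtain g where "act g w \<in> ball z (R / 2)"
      using minimal_action_meets_open[OF minimal, of "ball z (R / 2)"] R(1) by auto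
    then have "ret (act g w) (R / 2) \<subseteq> ret z R"
      by (intro ret_mono ball_subset_ball_half) auto
    then have "\<mu> (ret (act g w) (R / 2)) \<le> \<mu> (ret z R)" by (rule fin_add_prob_mono[OF prob])
    moreover have "common w w \<le> \<mu> (ret (act g w) (R / 2))"
      using common_le[of "R / 2" "act g w" "act g w"] R(1) by (simp add: common_act)
    ultimately show "common w w \<le> common z z + e" using R(2) by simp
  qed
  then show ?thesis by (simp add: antisym)
qed

text \<open>By minimality and compactness finitely many preimages of \<open>U\<close> cover the
  space, so finitely many translates of the visiting times \<open>E\<close> of \<open>z\<close>
  cover the group. Invariance makes \<open>\<mu> E\<close> positive, and \<open>E\<close> lies in
  every \<open>ret z r\<close>.\<close>

lemma common_self_pos: "0 < common z z"
proof -
  have cover: "UNIV \<subseteq> (\<Union>h. act h -` U)"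
  proof
    fix x
    obtain h where "act h x \<in> U" by (rule minimal_action_meets_open[OF minimal open_U U_nonempty])
    then show "x \<in> (\<Union>h. act h -` U)" by blast
  qed
  obtain H where H: "finite H" "UNIV \<subseteq> (\<Union>h\<in>H. act h -` U)"
    by (rule compactE_image[OF cpt _ cover])
      (auto intro!: open_vimage open_U continuous_action_continuous_on(1)[OF act])
  define E where "E = {g. act g z \<in> U}"
  have "UNIV \<subseteq> (\<Union>h\<in>H. (+) (- h) ` E)"
  proof
    fix g
    obtain h where h: "h \<in> H" "act h (act g z) \<in> U" using H(2) by blast
    then have "h + g \<in> E" by (simp add: E_def continuous_action_act(2)[OF act])
    then have "- h + (h + g) \<in> (+) (- h) ` E" by (rule imageI)
    then show "g \<in> (\<Union>h\<in>H. (+) (- h) ` E)" using h(1) by auto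
  qed
  then have "\<mu> UNIV \<le> \<mu> (\<Union>h\<in>H. (+) (- h) ` E)" by (rule fin_add_prob_mono[OF prob])
  also have "\<dots> \<le> (\<Sum>h\<in>H. \<mu> ((+) (- h) ` E))" by (rule fin_add_prob_UN_le[OF prob H(1)])
  also have "\<dots> = card H * \<mu> E" by (simp only: invariant sum_constant)
  finally have "\<mu> E \<noteq> 0" by (auto simp: fin_add_prob_UNIV[OF prob])
  then have "0 < \<mu> E" using fin_add_prob_nonneg[OF prob, of E] by simp
  also have "\<mu> E \<le> common z z"
    by (intro common_greatest fin_add_prob_mono[OF prob]) (auto simp: E_def ret_def intro: centre_in_ball[THEN iffD2])
  finally show ?thesis .
qed

text \<open>This becomes the triangle inequality for \<open>c - J\<close> once
  \<open>common y y\<close> is known to be the constant \<open>c\<close>. For the return sets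
  \<open>?X\<close>, \<open>?Y\<close>, \<open>?Z\<close>, the union of
  \<open>?X \<inter> ?Y\<close> and \<open>?Y \<inter> ?Z\<close> lies in \<open>?Y\<close> and
  their intersection in \<open>?X \<inter> ?Z\<close>.\<close>

lemma common_triangle: "common x y + common y z \<le> common y y + common x z"
proof (rule field_le_epsilon)
  fix e :: real assume "e > 0"
  then have e: "e / 2 > 0" by simp
  obtain R S where R: "R > 0" "\<And>r. r \<le> R \<Longrightarrow> \<mu> (ret y r \<inter> ret y r) < common y y + e / 2"
    and S: "S > 0" "\<And>r. r \<le> S \<Longrightarrow> \<mu> (ret x r \<inter> ret z r) < common x z + e / 2"
    using common_approx[OF e, of y y] common_approx[OF e, of x z] by metis
  define r where "r = min R S"
  have r: "r > 0" "r \<le> R" "r \<le> S" using R(1) S(1) by (auto simp: r_def)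
  let ?X = "ret x r" and ?Y = "ret y r" and ?Z = "ret z r"
  have "common x y + common y z \<le> \<mu> (?X \<inter> ?Y) + \<mu> (?Y \<inter> ?Z)"
    using common_le[OF r(1)] by (intro add_mono) auto
  also have "\<dots> = \<mu> ((?X \<inter> ?Y) \<union> (?Y \<inter> ?Z)) + \<mu> ((?X \<inter> ?Y) \<inter> (?Y \<inter> ?Z))"
    by (rule fin_add_prob_Un_Int[OF prob, symmetric])
  also have "\<dots> \<le> \<mu> (?Y \<inter> ?Y) + \<mu> (?X \<inter> ?Z)"
    by (intro add_mono fin_add_prob_mono[OF prob]) auto
  also have "\<dots> \<le> common y y + common x z + e"
    using R(2)[OF r(2)] S(2)[OF r(3)] by simp
  finally show "common x y + common y z \<le> common y y + common x z + e" .
qed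

text \<open>Nonnegativity of \<open>c - J\<close>, from the triangle inequality with equal
  endpoints.\<close>

lemma common_le_self: "common z w \<le> common z z"
  using common_triangle[of z w z] common_self_const[of z w] common_commute[of z w] by simp

text \<open>For small \<open>s\<close> both return sets have measure at least \<open>c\<close> and
  lie in \<open>ret z R\<close>, whose measure barely exceeds \<open>c\<close>. Hence they overlap
  in measure at least \<open>c - e / 2\<close>.\<close>

lemma common_near:
  assumes "e > 0"
  shows "\<exists>r>0. \<forall>w. dist z w < r \<longrightarrow> common z z - common z w < e"
proof -
  obtain R where R: "R > 0" "\<mu> (ret z R \<inter> ret z R) < common z z + e / 2"
    using assms by (metis common_approx half_gt_zero order_refl)
  have "common z z - common z w < e" if "dist z w < R / 2" for w
  proof -
    have "common z z - e / 2 \<le> common z w"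
    proof (rule common_greatest)
      fix r :: real assume "r > 0"
      \<comment> \<open>\<open>s \<le> r\<close> transfers the overlap to radius \<open>r\<close>,
        and \<open>s \<le> R / 2\<close> keeps \<open>ball w s\<close> inside
        \<open>ball z R\<close>.\<close>
      define s where "s = min r (R / 2)"
      have s: "s > 0" using \<open>r > 0\<close> R(1) by (simp add: s_def)
      have sub: "ret z s \<subseteq> ret z R" "ret w s \<subseteq> ret z R"
        using R(1) by (auto intro!: ret_mono subset_ball ball_subset_ball_half[OF that] simp del: mem_ball simp: s_def)
      have "\<mu> (ret z s \<union> ret w s) \<le> \<mu> (ret z R)"
        using sub by (intro fin_add_prob_mono[OF prob]) auto
      moreover have "\<mu> (ret z s \<union> ret w s) + \<mu> (ret z s \<inter> ret w s) = \<mu> (ret z s) + \<mu> (ret w s)"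
        by (rule fin_add_prob_Un_Int[OF prob])
      moreover have "common z z \<le> \<mu> (ret z s)" "common z z \<le> \<mu> (ret w s)"
        using common_le[OF s, of z z] common_le[OF s, of w w] common_self_const[of z w] by auto
      moreover have "\<mu> (ret z s \<inter> ret w s) \<le> \<mu> (ret z r \<inter> ret w r)"
        by (intro fin_add_prob_mono[OF prob] Int_mono ret_mono) (auto simp: s_def)
      ultimately show "common z z - e / 2 \<le> \<mu> (ret z r \<inter> ret w r)" using R(2) by simp
    qed
    then show ?thesis using assms by linarith
  qed
  then show ?thesis using R(1) by (intro exI[of _ "R / 2"]) auto
qed

text \<open>The bounded invariant pseudometric \<open>c - J\<close> vanishes on fibres by
  \<open>invariant_pseudometric_factors\<close>; constancy of \<open>common x x\<close> makes it
  symmetric.\<close>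

lemma common_eq_self:
  assumes "max_equicontinuous_factor act \<beta> Y \<pi>" "\<pi> x = \<pi> y"
  shows "common x y = common x x"
proof -
  have "common x x - common x y = 0"
  proof (rule invariant_pseudometric_factors[OF cpt act assms(1), where D = "\<lambda>x y. common x x - common x y" and B = 1])
    fix x y z g
    show "common x x - common x y = common y y - common y x"
      using common_self_const[of x y] common_commute[of x y] by simp
    show "common x x - common x z \<le> (common x x - common x y) + (common y y - common y z)"
      using common_triangle[of x y z] by simp
    show "common x x - common x y \<le> 1"
      using common_le_1[of x x] common_nonneg[of x y] by simp
  qed (auto simp: common_le_self common_act common_near assms(2))
  then show ?thesis by simp
qed

text \<open>The return set of \<open>xs 0\<close> has measure at least \<open>c\<close> but loses
  less than \<open>c / m\<close> when cut down to that of any single \<open>xs i\<close>, so some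
  \<open>g\<close> survives all \<open>m\<close> cuts.\<close>

lemma simultaneous_return:
  fixes xs :: "nat \<Rightarrow> 'x"
  assumes mef: "max_equicontinuous_factor act \<beta> Y \<pi>"
    and fibre: "\<And>i. i < m \<Longrightarrow> \<pi> (xs i) = y" and "r > 0"
  shows "\<exists>g ys. \<forall>i<m. ys i \<in> ball (xs i) r \<and> act g (ys i) \<in> U"
proof (cases "m = 0")
  case False
  define c where "c = common (xs 0) (xs 0)"
  have c: "c > 0" unfolding c_def by (rule common_self_pos)
  then have "c / m > 0" using False by simp
  then obtain R where R: "R > 0" "\<And>s. s \<le> R \<Longrightarrow> \<mu> (ret (xs 0) s \<inter> ret (xs 0) s) < c + c / m"
    unfolding c_def by (metis common_approx)
  define s where "s = min R r"
  have s: "s > 0" "s \<le> R" "s \<le> r" using R(1) \<open>r > 0\<close> by (auto simp: s_def)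
  define A where "A i = ret (xs i) s" for i
  have A0: "\<mu> (A 0) < c + c / m" using R(2)[OF s(2)] by (simp add: A_def)
  have diff: "\<mu> (A 0 - A i) < c / m" if "i < m" for i
  proof -
    have "common (xs 0) (xs i) = c"
      unfolding c_def using False fibre[of 0] fibre[OF that] by (intro common_eq_self[OF mef]) simp
    then have "c \<le> \<mu> (A 0 \<inter> A i)" using common_le[OF s(1), of "xs 0" "xs i"] by (simp add: A_def)
    then show ?thesis using A0 fin_add_prob_Diff[OF prob, of "A 0" "A i"] by simp
  qed
  have "\<mu> (\<Union>i\<in>{..<m}. A 0 - A i) \<le> (\<Sum>i<m. \<mu> (A 0 - A i))"
    by (rule fin_add_prob_UN_le[OF prob]) simp
  also have "\<dots> < (\<Sum>i<m. c / m)"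
    using False diff by (intro sum_strict_mono) auto
  also have "\<dots> = c" using False by simp
  also have "c \<le> \<mu> (A 0)" using common_le[OF s(1), of "xs 0" "xs 0"] by (simp add: A_def c_def)
  finally have "\<not> A 0 \<subseteq> (\<Union>i\<in>{..<m}. A 0 - A i)"
    using fin_add_prob_mono[OF prob] by (metis not_le)
  then obtain g where "\<And>i. i < m \<Longrightarrow> g \<in> A i" by blast
  then have "\<forall>i<m. \<exists>y. y \<in> ball (xs i) r \<and> act g y \<in> U"
    using subset_ball[OF s(3)] unfolding A_def ret_def by blast
  then obtain ys where "\<forall>i<m. ys i \<in> ball (xs i) r \<and> act g (ys i) \<in> U" by metis
  then show ?thesis by blast
qed simp

end

section \<open>Fibres of the maximal equicontinuous factor\<close>

context
  fixes act :: "'g::topological_ab_group_add \<Rightarrow> 'x::metric_space \<Rightarrow> 'x"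
    and \<beta> :: "'g \<Rightarrow> 'y::metric_space \<Rightarrow> 'y" and Y :: "'y set" and \<pi> :: "'x \<Rightarrow> 'y"
  assumes cpt: "compact (UNIV :: 'x set)" and act: "continuous_action act"
begin

text \<open>The key point of the introduction, freed of the auxiliary \<open>\<mu>\<close>.\<close>

lemma fibre_simultaneous_return:
  fixes xs :: "nat \<Rightarrow> 'x"
  assumes "minimal_action act" "max_equicontinuous_factor act \<beta> Y \<pi>"
    and "\<And>i. i < m \<Longrightarrow> \<pi> (xs i) = y" and "r > 0" and "open U" "U \<noteq> {}"
  obtains g ys where "\<And>i. i < m \<Longrightarrow> dist (xs i) (ys i) < r" "\<And>i. i < m \<Longrightarrow> act g (ys i) \<in> U"
proof -
  obtain \<mu> :: "'g set \<Rightarrow> real" where "fin_add_prob \<mu>" "\<And>h A. \<mu> ((+) h ` A) = \<mu> A"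
    by (metis exists_invariant_fin_add_prob)
  then interpret return_times act \<mu> U
    using assms cpt act by unfold_locales
  obtain g ys where "\<forall>i<m. ys i \<in> ball (xs i) r \<and> act g (ys i) \<in> U"
    using simultaneous_return[OF assms(2) _ assms(4), of m xs y] assms(3) by blast
  then show ?thesis by (intro that) auto
qed

text \<open>Simultaneous return for the pair, with a ball of radius \<open>e / 2\<close> as target:
  two points of it are within \<open>e\<close> of each other.\<close>

lemma same_fibre_imp_regionally_proximal:
  assumes "minimal_action act" "max_equicontinuous_factor act \<beta> Y \<pi>" "\<pi> x = \<pi> y"
  shows "(x, y) \<in> regionally_proximal act"
  unfolding regionally_proximal_def
proof (clarify)
  fix e :: real assume "e > 0"
  define xs where "xs i = (if i = 0 then x else y)" for i :: nat
  obtain g ys where ys: "\<And>i. i < 2 \<Longrightarrow> dist (xs i) (ys i) < e"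
    "\<And>i. i < 2 \<Longrightarrow> act g (ys i) \<in> ball x (e / 2)"
    by (rule fibre_simultaneous_return[OF assms(1,2), of 2 xs "\<pi> x" e "ball x (e / 2)"])
      (use \<open>e > 0\<close> assms(3) in \<open>auto simp: xs_def\<close>)
  have "dist (act g (ys 0)) (act g (ys 1)) < e"
    using ys(2)[of 0] ys(2)[of 1] by (auto intro: dist_triangle_half_r)
  then show "\<exists>x' y' g. dist x x' < e \<and> dist y y' < e \<and> dist (act g x') (act g y') < e"
    using ys(1)[of 0] ys(1)[of 1] by (auto simp: xs_def)
qed

text \<open>Uniform continuity of \<open>\<pi>\<close> makes the images of \<open>act g x\<close>
  and \<open>act g y\<close> close, and equicontinuity at \<open>- g\<close> carries this back to
  \<open>\<pi> x\<close> and \<open>\<pi> y\<close> with a bound independent of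
  \<open>g\<close>.\<close>

lemma equicontinuous_factor_contract:
  assumes "equicontinuous_factor act \<beta> Y \<pi>" "e > 0"
  obtains d where "d > 0"
    "\<And>g x y. dist (act g x) (act g y) < d \<Longrightarrow> dist (\<pi> x) (\<pi> y) < e"
    "\<And>x y. dist x y < d \<Longrightarrow> dist (\<pi> x) (\<pi> y) < e"
proof -
  have \<pi>: "continuous_on UNIV \<pi>" "range \<pi> = Y" "\<And>g x. \<pi> (act g x) = \<beta> g (\<pi> x)"
    and eq: "equicontinuous_on \<beta> Y"
    using assms(1) by (auto simp: equicontinuous_factor_def factor_map_def)
  obtain d' where d': "d' > 0"
    "\<And>y y' g. y \<in> Y \<Longrightarrow> y' \<in> Y \<Longrightarrow> dist y y' < d' \<Longrightarrow> dist (\<beta> g y) (\<beta> g y') < e"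
    using eq assms(2) unfolding equicontinuous_on_def by metis
  have "uniformly_continuous_on UNIV \<pi>"
    by (rule compact_uniformly_continuous[OF \<pi>(1) cpt])
  then obtain d where d: "d > 0" "\<And>x y. dist x y < d \<Longrightarrow> dist (\<pi> x) (\<pi> y) < d'"
    using d'(1) unfolding uniformly_continuous_on_def by (metis UNIV_I)
  have *: "dist (\<pi> x) (\<pi> y) < e" if "dist (act g x) (act g y) < d" for g x y
  proof -
    have "dist (\<beta> (- g) (\<pi> (act g x))) (\<beta> (- g) (\<pi> (act g y))) < e"
      using d(2)[OF that] \<pi>(2) by (intro d'(2)) auto
    then show ?thesis by (simp add: continuous_action_act[OF act] flip: \<pi>(3))
  qed
  show ?thesis
  proof (rule that[OF d(1) *])
    show "dist (\<pi> x) (\<pi> y) < e" if "dist x y < d" for x y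
      using *[of 0 x y] that by (simp add: continuous_action_act[OF act])
  qed
qed

lemma regionally_proximal_imp_same_fibre:
  assumes fac: "equicontinuous_factor act \<beta> Y \<pi>" and rp: "(x, y) \<in> regionally_proximal act"
  shows "\<pi> x = \<pi> y"
proof (rule ccontr)
  assume "\<pi> x \<noteq> \<pi> y"
  \<comment> \<open>The path from \<open>\<pi> x\<close> to \<open>\<pi> y\<close> through
    \<open>\<pi> x'\<close> and \<open>\<pi> y'\<close> has three steps, each shorter than a third
    of the total distance.\<close>
  then have pos: "dist (\<pi> x) (\<pi> y) / 3 > 0" by simp
  obtain d where d: "d > 0"
    "\<And>g x' y'. dist (act g x') (act g y') < d \<Longrightarrow> dist (\<pi> x') (\<pi> y') < dist (\<pi> x) (\<pi> y) / 3"
    "\<And>x' y'. dist x' y' < d \<Longrightarrow> dist (\<pi> x') (\<pi> y') < dist (\<pi> x) (\<pi> y) / 3"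
    using equicontinuous_factor_contract[OF fac pos] by metis
  obtain x' y' g where "dist x x' < d" "dist y y' < d" "dist (act g x') (act g y') < d"
    using rp d(1) unfolding regionally_proximal_def by blast
  then have "dist (\<pi> x) (\<pi> x') < dist (\<pi> x) (\<pi> y) / 3" "dist (\<pi> y) (\<pi> y') < dist (\<pi> x) (\<pi> y) / 3"
    "dist (\<pi> x') (\<pi> y') < dist (\<pi> x) (\<pi> y) / 3"
    using d(2,3) by blast+
  then show False
    using dist_triangle[of "\<pi> x" "\<pi> y" "\<pi> x'"] dist_triangle[of "\<pi> x'" "\<pi> y" "\<pi> y'"]
      dist_commute[of "\<pi> y" "\<pi> y'"] by linarith
qed

end

section \<open>Separated tuples in a fibre\<close>

lemma INF_dist_le:
  fixes act :: "'g::topological_ab_group_add \<Rightarrow> 'x::metric_space \<Rightarrow> 'x"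
  shows "(INF g. dist (act g x) (act g y)) \<le> dist (act h x) (act h y)"
  by (rule cINF_lower) (auto intro: bdd_belowI[of _ 0])

lemma not_proximal_iff:
  fixes act :: "'g::topological_ab_group_add \<Rightarrow> 'x::metric_space \<Rightarrow> 'x"
  shows "\<not> proximal act x y \<longleftrightarrow> (INF g. dist (act g x) (act g y)) > 0"
  using cINF_greatest[of UNIV 0 "\<lambda>g. dist (act g x) (act g y)"] by (auto simp: proximal_def)

text \<open>The condition with which all three conditions of the theorem are compared. Asking for a
  non-strict bound at every \<open>g\<close>, instead of a positive infimum, lets it pass to
  limits.\<close>

definition separated_fibre_tuple ::
  "('g::topological_ab_group_add \<Rightarrow> 'x::metric_space \<Rightarrow> 'x) \<Rightarrow> ('x \<Rightarrow> 'y) \<Rightarrow> nat \<Rightarrow> (nat \<Rightarrow> 'x) \<Rightarrow> real \<Rightarrow> bool"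
  where
  "separated_fibre_tuple act \<pi> m xs d \<longleftrightarrow> (\<forall>i<m. \<pi> (xs i) = \<pi> (xs 0)) \<and>
     (\<forall>i<m. \<forall>j<m. i \<noteq> j \<longrightarrow> (\<forall>g. d \<le> dist (act g (xs i)) (act g (xs j))))"

lemma separated_fibre_tupleD:
  assumes "separated_fibre_tuple act \<pi> m xs d" "i < m"
  shows "\<pi> (xs i) = \<pi> (xs 0)" "j < m \<Longrightarrow> i \<noteq> j \<Longrightarrow> d \<le> dist (act g (xs i)) (act g (xs j))"
  using assms unfolding separated_fibre_tuple_def by blast+

lemma enat_le_coincidence_rank_iff:
  assumes "range \<pi> = Y" "m > 0"
  shows "enat m \<le> coincidence_rank act Y \<pi> \<longleftrightarrow> (\<exists>xs. \<exists>d>0. separated_fibre_tuple act \<pi> m xs d)"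
proof
  assume "\<exists>xs. \<exists>d>0. separated_fibre_tuple act \<pi> m xs d"
  then obtain xs d where d: "d > 0" and tuple: "separated_fibre_tuple act \<pi> m xs d" by blast
  note fibre = separated_fibre_tupleD(1)[OF tuple] and sep = separated_fibre_tupleD(2)[OF tuple]
  have "\<not> proximal act (xs i) (xs j)" if "i < m" "j < m" "i \<noteq> j" for i j
    unfolding not_proximal_iff using d
    by (rule less_le_trans) (rule cINF_greatest, simp, rule sep[OF that])
  then have "enat m \<in> {enat n | n. \<exists>y\<in>Y. \<exists>xs :: nat \<Rightarrow> _. (\<forall>i<n. \<pi> (xs i) = y) \<and>
      (\<forall>i<n. \<forall>j<n. i \<noteq> j \<longrightarrow> \<not> proximal act (xs i) (xs j))}"
    using fibre assms(1) by blast
  then show "enat m \<le> coincidence_rank act Y \<pi>"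
    unfolding coincidence_rank_def by (rule Sup_upper)
next
  assume "enat m \<le> coincidence_rank act Y \<pi>"
  \<comment> \<open>Passing to \<open>m - 1\<close> gives a strict inequality below the supremum,
    hence a member \<open>n \<ge> m\<close> of the set; the first \<open>m\<close> points of its
    tuple suffice.\<close>
  moreover have "enat (m - 1) < enat m" using assms(2) by simp
  ultimately have "enat (m - 1) < coincidence_rank act Y \<pi>" by (rule less_le_trans[rotated])
  then obtain N where N: "enat (m - 1) < N" "N \<in> {enat n | n. \<exists>y\<in>Y. \<exists>xs :: nat \<Rightarrow> _.
      (\<forall>i<n. \<pi> (xs i) = y) \<and> (\<forall>i<n. \<forall>j<n. i \<noteq> j \<longrightarrow> \<not> proximal act (xs i) (xs j))}"
    unfolding coincidence_rank_def less_Sup_iff by blast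
  from N(2) obtain n y and xs :: "nat \<Rightarrow> _" where "N = enat n"
    and fibre: "\<forall>i<n. \<pi> (xs i) = y"
    and np: "\<forall>i<n. \<forall>j<n. i \<noteq> j \<longrightarrow> \<not> proximal act (xs i) (xs j)"
    by (elim CollectE exE conjE bexE)
  then have n: "m \<le> n" using N(1) by simp
  define P where "P = {(i, j). i < m \<and> j < m \<and> i \<noteq> j}"
  define D where "D = (\<lambda>(i, j). INF g. dist (act g (xs i)) (act g (xs j)))"
  have "finite P" by (rule finite_subset[of _ "{..<m} \<times> {..<m}"]) (auto simp: P_def)
  \<comment> \<open>The least of finitely many positive infima; the entry 1 keeps the set nonempty
    when \<open>m = 1\<close>.\<close>
  define d where "d = Min (insert 1 (D ` P))"
  have "d > 0"
    unfolding d_def using \<open>finite P\<close> np n by (auto simp: P_def D_def not_proximal_iff)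
  moreover have "d \<le> dist (act g (xs i)) (act g (xs j))" if "i < m" "j < m" "i \<noteq> j" for i j g
  proof -
    have "d \<le> D (i, j)"
      unfolding d_def using \<open>finite P\<close> that by (intro Min_le) (auto simp: P_def)
    also have "\<dots> \<le> dist (act g (xs i)) (act g (xs j))" by (simp add: D_def INF_dist_le)
    finally show ?thesis .
  qed
  moreover have "\<pi> (xs i) = \<pi> (xs 0)" if "i < m" for i
    using that n fibre by simp
  ultimately show "\<exists>xs. \<exists>d>0. separated_fibre_tuple act \<pi> m xs d"
    unfolding separated_fibre_tuple_def by blast
qed

section \<open>Passage between separated fibre tuples and compact sensitivity\<close>

lemma continuous_action_uniform_near:
  fixes act :: "'g::topological_ab_group_add \<Rightarrow> 'x::metric_space \<Rightarrow> 'x"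
  assumes act: "continuous_action act" and "compact K" "e > 0"
  obtains r where "r > 0" "\<And>y k. dist x y < r \<Longrightarrow> k \<in> K \<Longrightarrow> dist (act k x) (act k y) < e"
proof -
  \<comment> \<open>An open set of pairs, point first, containing \<open>{x} \<times> K\<close>; the
    tube lemma thickens \<open>x\<close> to a neighbourhood that works for all of
    \<open>K\<close>.\<close>
  define W where "W = {p. dist (act (snd p) x) (act (snd p) (fst p)) < e}"
  have "continuous_on UNIV (\<lambda>(g, x). act g x)" using act by (simp add: continuous_action_def)
  note * = continuous_on_compose2[OF this, of UNIV]
  have "open W"
    unfolding W_def
  proof (intro open_Collect_less continuous_intros)
    show "continuous_on UNIV (\<lambda>p. act (snd p) x)"
      using *[of "\<lambda>p. (snd p, x)"] by (simp add: continuous_on_Pair continuous_on_snd)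
    show "continuous_on UNIV (\<lambda>p. act (snd p) (fst p))"
      using *[of "\<lambda>p. (snd p, fst p)"] by (simp add: continuous_on_Pair continuous_on_snd continuous_on_fst)
  qed
  moreover have "{x} \<times> K \<subseteq> W" using \<open>e > 0\<close> by (auto simp: W_def)
  ultimately have "\<exists>X. x \<in> X \<and> open X \<and> X \<times> K \<subseteq> W"
    by (rule Elementary_Topology.tube_lemma[OF assms(2)])
  then obtain X where X: "x \<in> X" "open X" "X \<times> K \<subseteq> W" by (elim exE conjE)
  then obtain r where r: "r > 0" "ball x r \<subseteq> X" using openE by blast
  show ?thesis
  proof (rule that[OF r(1)])
    fix y k assume "dist x y < r" "k \<in> K"
    then have "(y, k) \<in> X \<times> K" using r(2) by auto
    then show "dist (act k x) (act k y) < e" using X(3) by (auto simp: W_def)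
  qed
qed

text \<open>Points \<open>ys i\<close> so close to \<open>xs i\<close> that \<open>K\<close> moves
  them at most \<open>d / 4\<close> apart stay more than \<open>d / 4\<close> from each other over
  \<open>K\<close>. The key point supplies such points that one \<open>g\<close> carries into
  \<open>U\<close>.\<close>

lemma separated_fibre_tuple_imp_sensitive:
  fixes act :: "'g::topological_ab_group_add \<Rightarrow> 'x::metric_space \<Rightarrow> 'x"
  assumes cpt: "compact (UNIV :: 'x set)" and act: "continuous_action act"
    and minimal: "minimal_action act" and mef: "max_equicontinuous_factor act \<beta> Y \<pi>"
    and d: "d > 0" and tuple: "separated_fibre_tuple act \<pi> m xs d"
  shows "compactly_m_sensitive act m"
  unfolding compactly_m_sensitive_def
proof (intro exI[of _ "d / 4"] conjI allI impI)
  show "d / 4 > 0" using d by simp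
  fix U :: "'x set" and K :: "'g set"
  assume U: "open U \<and> U \<noteq> {}" and K: "compact K"
  have "\<exists>r>0. \<forall>y k. dist (xs i) y < r \<longrightarrow> k \<in> K \<longrightarrow> dist (act k (xs i)) (act k y) < d / 4" for i
    using continuous_action_uniform_near[OF act K \<open>d / 4 > 0\<close>, of "xs i"] by metis
  then obtain R where R: "\<And>i. R i > 0"
    "\<And>i y k. dist (xs i) y < R i \<Longrightarrow> k \<in> K \<Longrightarrow> dist (act k (xs i)) (act k y) < d / 4" by metis
  define r where "r = Min (insert 1 (R ` {..<m}))"
  have r: "r > 0" "\<And>i. i < m \<Longrightarrow> r \<le> R i" using R(1) by (auto simp: r_def)
  note fibre = separated_fibre_tupleD(1)[OF tuple] and sep = separated_fibre_tupleD(2)[OF tuple]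
  obtain g ys where ys: "\<And>i. i < m \<Longrightarrow> dist (xs i) (ys i) < r" "\<And>i. i < m \<Longrightarrow> act g (ys i) \<in> U"
    using fibre_simultaneous_return[OF cpt act minimal mef, of m xs "\<pi> (xs 0)" r U] fibre r(1) U
    by metis
  have "d / 4 < dist (act (k - g) (act g (ys i))) (act (k - g) (act g (ys j)))"
    if "k \<in> K" "i < m" "j < m" "i \<noteq> j" for k i j
  proof -
    have near: "dist (act k (xs l)) (act k (ys l)) < d / 4" if "l < m" for l
      using R(2)[OF less_le_trans[OF ys(1)[OF that] r(2)[OF that]] \<open>k \<in> K\<close>] .
    have "d \<le> dist (act k (xs i)) (act k (xs j))" by (rule sep) (use that in auto)
    then have "d / 4 < dist (act k (ys i)) (act k (ys j))"
      using near[OF \<open>i < m\<close>] near[OF \<open>j < m\<close>] d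
        dist_triangle[of "act k (xs i)" "act k (xs j)" "act k (ys i)"]
        dist_triangle[of "act k (ys i)" "act k (xs j)" "act k (ys j)"]
        dist_commute[of "act k (xs j)" "act k (ys j)"] by linarith
    moreover have "act (k - g) (act g z) = act k z" for z
      using continuous_action_act(2)[OF act, of "k - g" g z] by simp
    ultimately show ?thesis by simp
  qed
  then show "\<exists>xs h. (\<forall>i<m. xs i \<in> U) \<and> (\<lambda>k. k + h) ` K \<subseteq>
      {g. \<forall>i<m. \<forall>j<m. i \<noteq> j \<longrightarrow> dist (act g (xs i)) (act g (xs j)) > d / 4}"
    \<comment> \<open>The shift \<open>- g\<close> cancels the \<open>g\<close> that moved the
      points into \<open>U\<close>, so over \<open>K\<close> the separation is that of the
      \<open>ys i\<close>.\<close>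
    using ys(2) by (intro exI[of _ "\<lambda>i. act g (ys i)"] exI[of _ "- g"]) auto
qed

text \<open>Finite unions make each \<open>g\<close> belong to all late sets, a property that
  survives passing to a subsequence.\<close>

lemma sigma_compact_type_incseq:
  assumes "sigma_compact_type TYPE('g::topological_space)"
  obtains K :: "nat \<Rightarrow> 'g::topological_space set"
  where "\<And>n. compact (K n)" "\<And>g. \<forall>\<^sub>F n in sequentially. g \<in> K n"
proof -
  obtain L :: "nat \<Rightarrow> 'g set" where L: "\<And>n. compact (L n)" "(\<Union>n. L n) = UNIV"
    using assms by (auto simp: sigma_compact_type_def)
  show ?thesis
  proof (rule that)
    show "compact (\<Union>i\<le>n. L i)" for n using L(1) by (intro compact_UN) auto
    fix g
    obtain i where "g \<in> L i" using L(2) by blast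
    then show "\<forall>\<^sub>F n in sequentially. g \<in> (\<Union>i\<le>n. L i)"
      by (auto intro!: eventually_sequentiallyI[of i])
  qed
qed

text \<open>Sensitivity is applied to shrinking balls and growing compact sets \<open>K n\<close>.
  After the push by \<open>h n\<close> the tuples are separated over \<open>K n\<close>, so a limit
  is separated over the whole group; pulling back by \<open>- h n\<close> shows that its points
  share a fibre.\<close>

lemma sensitive_imp_separated_fibre_tuple:
  fixes act :: "'g::topological_ab_group_add \<Rightarrow> 'x::metric_space \<Rightarrow> 'x"
  assumes \<sigma>: "sigma_compact_type TYPE('g)"
    and cpt: "compact (UNIV :: 'x set)" and act: "continuous_action act"
    and fac: "equicontinuous_factor act \<beta> Y \<pi>" and sens: "compactly_m_sensitive act m"
  shows "\<exists>xs. \<exists>d>0. separated_fibre_tuple act \<pi> m xs d"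
proof -
  obtain K :: "nat \<Rightarrow> 'g set" where K: "\<And>n. compact (K n)" "\<And>g. \<forall>\<^sub>F n in sequentially. g \<in> K n"
    by (rule sigma_compact_type_incseq[OF \<sigma>]) blast
  obtain e where e: "e > 0" and sens': "\<forall>U. open U \<and> U \<noteq> {} \<longrightarrow> (\<forall>K. compact K \<longrightarrow>
      (\<exists>(xs :: nat \<Rightarrow> 'x) h. (\<forall>i<m. xs i \<in> U) \<and> (\<lambda>k. k + h) ` K \<subseteq>
        {g. \<forall>i<m. \<forall>j<m. i \<noteq> j \<longrightarrow> dist (act g (xs i)) (act g (xs j)) > e}))"
    using sens unfolding compactly_m_sensitive_def by (elim exE conjE)
  \<comment> \<open>An arbitrary centre for the balls.\<close>
  define x :: 'x where "x = undefined"
  have "\<forall>n. \<exists>(xs :: nat \<Rightarrow> 'x) h. (\<forall>i<m. xs i \<in> ball x (1 / real (Suc n))) \<and> (\<lambda>k. k + h) ` K n \<subseteq>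
      {g. \<forall>i<m. \<forall>j<m. i \<noteq> j \<longrightarrow> dist (act g (xs i)) (act g (xs j)) > e}"
    by (intro allI sens'[rule_format] K(1)) auto
  from choice[OF this] obtain xs :: "nat \<Rightarrow> nat \<Rightarrow> 'x" where
    "\<forall>n. \<exists>h. (\<forall>i<m. xs n i \<in> ball x (1 / real (Suc n))) \<and> (\<lambda>k. k + h) ` K n \<subseteq>
      {g. \<forall>i<m. \<forall>j<m. i \<noteq> j \<longrightarrow> dist (act g (xs n i)) (act g (xs n j)) > e}"
    by (elim exE)
  from choice[OF this] obtain h :: "nat \<Rightarrow> 'g" where
    xs_h: "\<forall>n. (\<forall>i<m. xs n i \<in> ball x (1 / real (Suc n))) \<and> (\<lambda>k. k + h n) ` K n \<subseteq>
      {g. \<forall>i<m. \<forall>j<m. i \<noteq> j \<longrightarrow> dist (act g (xs n i)) (act g (xs n j)) > e}"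
    by (elim exE)
  have xs: "dist x (xs n i) < 1 / real (Suc n)" if "i < m" for n i
    using spec[OF xs_h, of n] that unfolding mem_ball by blast
  have far: "(\<lambda>k. k + h n) ` K n \<subseteq>
      {g. \<forall>i<m. \<forall>j<m. i \<noteq> j \<longrightarrow> dist (act g (xs n i)) (act g (xs n j)) > e}" for n
    using spec[OF xs_h, of n] by (rule conjunct2)
  define zs where "zs n i = act (h n) (xs n i)" for n i
  have zs_far: "e < dist (act k (zs n i)) (act k (zs n j))"
    if "k \<in> K n" "i < m" "j < m" "i \<noteq> j" for k n i j
  proof -
    have "k + h n \<in> {g. \<forall>i<m. \<forall>j<m. i \<noteq> j \<longrightarrow> dist (act g (xs n i)) (act g (xs n j)) > e}"
      using far[of n] that(1) by blast
    then show ?thesis using that by (simp add: zs_def continuous_action_act(2)[OF act])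
  qed
  \<comment> \<open>Whole sequences are taken to converge at once, so one subsequence serves all
    indices.\<close>
  have "compact (PiE UNIV (\<lambda>_. UNIV) :: (nat \<Rightarrow> 'x) set)" by (rule compact_PiE_UNIV[OF cpt])
  then have "seq_compact (UNIV :: (nat \<Rightarrow> 'x) set)" by (simp add: compact_imp_seq_compact)
  then obtain l r where r: "strict_mono r" "(zs \<circ> r) \<longlonglongrightarrow> l"
    by (rule seq_compactE[of _ zs]) auto
  have lim: "(\<lambda>n. zs (r n) i) \<longlonglongrightarrow> l i" for i
    using continuous_on_tendsto_compose[OF continuous_on_product_coordinates r(2), of i] by simp
  \<comment> \<open>Each \<open>k\<close> lies in \<open>K (r n)\<close> for all large
    \<open>n\<close>; the strict bound weakens to \<open>\<le>\<close> in the limit.\<close>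
  have sep: "e \<le> dist (act k (l i)) (act k (l j))" if "i < m" "j < m" "i \<noteq> j" for k i j
  proof (rule tendsto_lowerbound)
    have "(\<lambda>n. act k (zs (r n) i)) \<longlonglongrightarrow> act k (l i)" for i
      using continuous_on_tendsto_compose[OF continuous_action_continuous_on(1)[OF act] lim] by simp
    then show "(\<lambda>n. dist (act k (zs (r n) i)) (act k (zs (r n) j))) \<longlonglongrightarrow> dist (act k (l i)) (act k (l j))"
      by (intro tendsto_dist)
    have "\<forall>\<^sub>F n in sequentially. k \<in> K (r n)"
      using K(2) by (rule eventually_subseq[OF r(1)])
    then show "\<forall>\<^sub>F n in sequentially. e \<le> dist (act k (zs (r n) i)) (act k (zs (r n) j))"
      by eventually_elim (rule less_imp_le[OF zs_far[OF _ that]])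
  qed simp
  have fibre: "\<pi> (l i) = \<pi> (l j)" if "i < m" "j < m" for i j
  proof -
    have \<pi>: "continuous_on UNIV \<pi>" using fac unfolding equicontinuous_factor_def factor_map_def by blast
    have \<pi>_lim: "(\<lambda>n. \<pi> (zs (r n) i)) \<longlonglongrightarrow> \<pi> (l i)" for i
      by (rule continuous_on_tendsto_compose[OF \<pi> lim]) auto
    have "dist (\<pi> (l i)) (\<pi> (l j)) \<le> c" if "c > 0" for c
    proof (rule tendsto_upperbound)
      show "(\<lambda>n. dist (\<pi> (zs (r n) i)) (\<pi> (zs (r n) j))) \<longlonglongrightarrow> dist (\<pi> (l i)) (\<pi> (l j))"
        by (intro tendsto_dist \<pi>_lim)
      obtain d where d: "d > 0"
        "\<And>g x y. dist (act g x) (act g y) < d \<Longrightarrow> dist (\<pi> x) (\<pi> y) < c"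
        using equicontinuous_factor_contract[OF cpt act fac \<open>c > 0\<close>] by metis
      have "(\<lambda>n. 1 / real (Suc n)) \<longlonglongrightarrow> 0" by (rule LIMSEQ_Suc[OF lim_1_over_n])
      then have "\<forall>\<^sub>F n in sequentially. 1 / real (Suc n) < d / 2"
        by (rule order_tendstoD) (use d(1) in simp)
      then have "\<forall>\<^sub>F n in sequentially. 1 / real (Suc (r n)) < d / 2"
        by (rule eventually_subseq[OF r(1)])
      then show "\<forall>\<^sub>F n in sequentially. dist (\<pi> (zs (r n) i)) (\<pi> (zs (r n) j)) \<le> c"
      proof eventually_elim
        case (elim n)
        have "dist (xs (r n) i) (xs (r n) j) < d"
          using elim xs[OF \<open>i < m\<close>, of "r n"] xs[OF \<open>j < m\<close>, of "r n"]
            dist_triangle3[of "xs (r n) i" "xs (r n) j" x] by linarith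
        \<comment> \<open>The group element \<open>- h (r n)\<close> undoes the push, and the
          contraction bound does not depend on it.\<close>
        then have "dist (act (- h (r n)) (zs (r n) i)) (act (- h (r n)) (zs (r n) j)) < d"
          by (simp add: zs_def continuous_action_act[OF act])
        then show ?case by (rule less_imp_le[OF d(2)])
      qed
    qed simp
    then have "dist (\<pi> (l i)) (\<pi> (l j)) \<le> 0" by (rule field_le_epsilon) simp
    then show ?thesis by simp
  qed
  show ?thesis
    unfolding separated_fibre_tuple_def
  proof (intro exI[of _ l] exI[of _ e] conjI allI impI)
    show "\<pi> (l i) = \<pi> (l 0)" if "i < m" for i
      using that by (intro fibre) auto
    show "e > 0" by (rule e)
    show "e \<le> dist (act g (l i)) (act g (l j))" if "i < m" "j < m" "i \<noteq> j" for i j g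
      using that by (rule sep)
  qed
qed

section \<open>Equivalence of sensitivity, separated regionally proximal tuples and the rank
  bound\<close>

theorem theorem5p5:
  fixes act :: "'g::{topological_ab_group_add, t2_space} \<Rightarrow> 'x::metric_space \<Rightarrow> 'x"
    and \<beta> :: "'g \<Rightarrow> 'y::metric_space \<Rightarrow> 'y"
    and Y :: "'y set"
    and \<pi> :: "'x \<Rightarrow> 'y"
    and m :: nat
  assumes "locally_compact_space (euclidean :: 'g topology)"
    and "sigma_compact_type TYPE('g)"
    and "compact (UNIV :: 'x set)"
    and "continuous_action act"
    and "minimal_action act"
    and "max_equicontinuous_factor act \<beta> Y \<pi>"
    and "m \<ge> 2"
  shows "(compactly_m_sensitive act m \<longleftrightarrow>
           (\<exists>\<delta>>0. \<forall>U. open U \<and> U \<noteq> {} \<longrightarrow>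
              (\<exists>xs :: nat \<Rightarrow> 'x. xs 0 \<in> U \<and>
                 (\<forall>i<m. \<forall>j<m. (xs i, xs j) \<in> regionally_proximal act) \<and>
                 (\<forall>i<m. \<forall>j<m. i \<noteq> j \<longrightarrow> (INF g. dist (act g (xs i)) (act g (xs j))) > \<delta>))))
       \<and> (compactly_m_sensitive act m \<longleftrightarrow> enat m \<le> coincidence_rank act Y \<pi>)"
    (is "(_ \<longleftrightarrow> ?pairs) \<and> _")
proof -
  note act = assms(4) and minimal = assms(5) and mef = assms(6)
  have fac: "equicontinuous_factor act \<beta> Y \<pi>"
    using mef by (simp add: max_equicontinuous_factor_def)
  then have range: "range \<pi> = Y" and equivariant: "\<And>g x. \<pi> (act g x) = \<beta> g (\<pi> x)"
    by (auto simp: equicontinuous_factor_def factor_map_def)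
  define T where "T \<longleftrightarrow> (\<exists>xs. \<exists>d>0. separated_fibre_tuple act \<pi> m xs d)"
  have rank: "enat m \<le> coincidence_rank act Y \<pi> \<longleftrightarrow> T"
    unfolding T_def by (rule enat_le_coincidence_rank_iff[OF range]) (use assms(7) in simp)
  have sens: "compactly_m_sensitive act m \<longleftrightarrow> T"
    unfolding T_def
    using sensitive_imp_separated_fibre_tuple[OF assms(2,3) act fac]
      separated_fibre_tuple_imp_sensitive[OF assms(3) act minimal mef] by blast
  have "?pairs \<longleftrightarrow> T"
  proof
    assume ?pairs
    then obtain \<delta> where "\<delta> > 0" and \<delta>: "\<forall>U. open U \<and> U \<noteq> {} \<longrightarrow> (\<exists>xs :: nat \<Rightarrow> 'x. xs 0 \<in> U \<and>
        (\<forall>i<m. \<forall>j<m. (xs i, xs j) \<in> regionally_proximal act) \<and>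
        (\<forall>i<m. \<forall>j<m. i \<noteq> j \<longrightarrow> (INF g. dist (act g (xs i)) (act g (xs j))) > \<delta>))"
      by blast
    obtain xs :: "nat \<Rightarrow> 'x" where
      rp: "\<forall>i<m. \<forall>j<m. (xs i, xs j) \<in> regionally_proximal act"
      and sep: "\<forall>i<m. \<forall>j<m. i \<noteq> j \<longrightarrow> (INF g. dist (act g (xs i)) (act g (xs j))) > \<delta>"
      \<comment> \<open>A single tuple is extracted by choosing the whole space as
        \<open>U\<close>.\<close>
      using \<delta>[rule_format, of UNIV] by auto
    have "\<pi> (xs i) = \<pi> (xs 0)" if "i < m" for i
      using rp that assms(7) by (intro regionally_proximal_imp_same_fibre[OF assms(3) act fac]) auto
    moreover have "\<delta> \<le> dist (act g (xs i)) (act g (xs j))" if "i < m" "j < m" "i \<noteq> j" for i j g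
    proof -
      have "\<delta> \<le> (INF g. dist (act g (xs i)) (act g (xs j)))"
        using sep that by (simp add: less_imp_le)
      also have "\<dots> \<le> dist (act g (xs i)) (act g (xs j))" by (rule INF_dist_le)
      finally show ?thesis .
    qed
    ultimately show T using \<open>\<delta> > 0\<close> unfolding T_def separated_fibre_tuple_def by blast
  next
    assume T
    then obtain xs d where d: "d > 0" and tuple: "separated_fibre_tuple act \<pi> m xs d"
      unfolding T_def by blast
    note fibre = separated_fibre_tupleD(1)[OF tuple] and sep = separated_fibre_tupleD(2)[OF tuple]
    show ?pairs
    \<comment> \<open>The tuple is translated so that its first point enters \<open>U\<close>.
      Equivariance keeps it in one fibre and the orbit distances are unchanged; halving
      \<open>d\<close> makes the bound on the infimum strict.\<close>
    proof (intro exI[of _ "d / 2"] conjI allI impI)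
      show "d / 2 > 0" using d by simp
      fix U :: "'x set" assume "open U \<and> U \<noteq> {}"
      then obtain g where g: "act g (xs 0) \<in> U"
        using minimal_action_meets_open[OF minimal] by blast
      have "(act g (xs i), act g (xs j)) \<in> regionally_proximal act" if "i < m" "j < m" for i j
        using fibre[OF that(1)] fibre[OF that(2)]
        by (intro same_fibre_imp_regionally_proximal[OF assms(3) act minimal mef]) (simp add: equivariant)
      moreover have "d / 2 < (INF h. dist (act h (act g (xs i))) (act h (act g (xs j))))"
        if "i < m" "j < m" "i \<noteq> j" for i j
      proof -
        have "d \<le> (INF h. dist (act h (act g (xs i))) (act h (act g (xs j))))"
          using sep[OF that]
          by (intro cINF_greatest) (simp_all flip: continuous_action_act(2)[OF act])
        then show ?thesis using d by simp
      qed
      ultimately show "\<exists>xs. xs 0 \<in> U \<and> (\<forall>i<m. \<forall>j<m. (xs i, xs j) \<in> regionally_proximal act) \<and>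
          (\<forall>i<m. \<forall>j<m. i \<noteq> j \<longrightarrow> (INF g. dist (act g (xs i)) (act g (xs j))) > d / 2)"
        using g by (intro exI[of _ "\<lambda>i. act g (xs i)"]) blast
    qed
  qed
  then show ?thesis using rank sens by blast
qed

end
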